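(* For all $p,q\in\mathbb{N}_0$ and all integers $n\ge 1$, \[ \sum_{k=1}^n\binom{p+n}{k}\binom{q+n}{n-k}\,k\,H_{p+n-k}H_{q+k} =(p+n)\binom{p+q+2n-1}{n-1}\Big\{\big(H_{p+q+n}^{\langle 2\rangle}-H_{p+q+2n-1}^{\langle 2\rangle}\big)+\big(H_{p+n-1}+H_{p+q+n}-H_{p+q+2n-1}\big)\big(H_{q+n}+H_{p+q+n}-H_{p+q+2n-1}\big)\Big\}. \]
   Context: $\mathbb{N}_0$ denotes the set of nonnegative integers and $\mathbb{N}$ the set of positive integers. For $l\in\mathbb{N}$ the generalized harmonic numbers are $H_0^{\langle l\rangle}=0$ and $H_n^{\langle l\rangle}=\sum_{k=1}^n\frac{1}{k^l}$ for $n\ge 1$. The classical harmonic numbers are $H_n=H_n^{\langle 1\rangle}$, so $H_0=0$ and $H_n=\sum_{k=1}^n\frac1k$. *)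

theory Defs
  imports "HOL-Analysis.Harmonic_Numbers"
begin

definition gen_harm :: "nat \<Rightarrow> nat \<Rightarrow> real" where
  "gen_harm l n = (\<Sum>k=1..n. 1 / real k ^ l)"

lemma gen_harm_0 [simp]: "gen_harm l 0 = 0"
  by (simp add: gen_harm_def)

lemma gen_harm_1: "gen_harm 1 n = harm n"
  by (simp add: gen_harm_def harm_def divide_inverse)

end

theory Submission
  imports Defs
begin

text \<open>
  The sum is obtained from partial derivatives, up to the mixed second one, of the convolution
  \<open>(\<Sum>j\<le>m. (x gchoose j) * (y gchoose (m - j))) = (x + y) gchoose m\<close>,
  read as an identity between polynomials in real \<open>x\<close> and \<open>y\<close>. The logarithmic derivative of
  \<open>x gchoose k\<close> is \<open>\<Sum>i<k. 1 / (x - i)\<close>, which at a natural number \<open>x = N \<ge> k\<close> equals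
  \<open>harm N - harm (N - k)\<close>. So \<open>\<partial>/\<partial>x\<close> inserts a factor \<open>harm N - harm (N - j)\<close> into the
  convolution, \<open>\<partial>/\<partial>y\<close> inserts \<open>harm M - harm (M - (m - j))\<close>, and \<open>\<partial>\<^sup>2/\<partial>x\<partial>y\<close> inserts both. On the
  right-hand side, which depends on \<open>x + y\<close> only, the same operations insert \<open>D\<close>, \<open>D\<close> and
  \<open>D\<^sup>2 - E\<close>, where \<open>D = harm (N + M) - harm (N + M - m)\<close> and \<open>E\<close> is the analogous difference of
  harmonic numbers of order two.

  Writing \<open>harm (N - j) = harm N - u\<close> and \<open>harm (M - (m - j)) = harm M - v\<close>, the product of the two
  expands into \<open>1\<close>, \<open>u\<close>, \<open>v\<close> and \<open>u * v\<close> with coefficients independent of \<open>j\<close>, and the four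
  identities sum it to \<open>(N + M choose m) * ((harm N - D) * (harm M - D) - E)\<close>
  (lemma \<open>Vandermonde_harm_harm\<close>). The theorem follows by absorbing the factor \<open>k\<close>,
  \<open>k * (p + n choose k) = (p + n) * (p + n - 1 choose k - 1)\<close>, which leads to
  \<open>N = p + n - 1\<close>, \<open>M = q + n\<close> and \<open>m = n - 1\<close>.
\<close>

text \<open>For \<open>l = 1\<close> this is the logarithmic derivative of \<open>x gchoose k\<close>, and for \<open>l = 2\<close> it is minus
  the derivative of the case \<open>l = 1\<close>.\<close>

definition falling_power_sum :: "nat \<Rightarrow> real \<Rightarrow> nat \<Rightarrow> real" where
  "falling_power_sum l x k = (\<Sum>i<k. 1 / (x - real i) ^ l)"

lemma gen_harm_Suc: "gen_harm l (Suc n) = gen_harm l n + 1 / real (Suc n) ^ l"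
  by (simp add: gen_harm_def)

lemma falling_power_sum_of_nat:
  "k \<le> N \<Longrightarrow> falling_power_sum l (real N) k = gen_harm l N - gen_harm l (N - k)"
proof (induction k)
  case 0
  then show ?case by (simp add: falling_power_sum_def)
next
  case (Suc k)
  then have eq: "N - k = Suc (N - Suc k)" by simp
  have diff: "real N - real k = real (Suc (N - Suc k))"
    using Suc.prems eq by linarith
  have "falling_power_sum l (real N) (Suc k)
      = falling_power_sum l (real N) k + 1 / real (Suc (N - Suc k)) ^ l"
    by (simp only: falling_power_sum_def sum.lessThan_Suc diff)
  also have "falling_power_sum l (real N) k = gen_harm l N - gen_harm l (Suc (N - Suc k))"
    using Suc eq by simp
  finally show ?case by (simp add: gen_harm_Suc)
qed

text \<open>The bound on \<open>x\<close> keeps every factor \<open>x - i\<close> of the falling factorial positive, so that the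
  logarithmic derivative exists.\<close>

lemma DERIV_gbinomial:
  assumes "real k < x + 1"
  shows "((\<lambda>x. x gchoose k) has_real_derivative (x gchoose k) * falling_power_sum 1 x k) (at x)"
  using assms
proof (induction k)
  case 0
  then show ?case by (simp add: falling_power_sum_def)
next
  case (Suc k)
  have rec: "z gchoose Suc k = (z gchoose k) * (z - real k) / real (Suc k)" for z :: real
    by (simp add: gbinomial_prod_rev)
  have "((\<lambda>x. (x gchoose k) * (x - real k) / real (Suc k)) has_real_derivative
      ((x gchoose k) * falling_power_sum 1 x k * (x - real k) + (x gchoose k)) / real (Suc k)) (at x)"
    using Suc by (auto intro!: derivative_eq_intros)
  moreover have "((x gchoose k) * falling_power_sum 1 x k * (x - real k) + (x gchoose k)) / real (Suc k)
      = (x gchoose Suc k) * falling_power_sum 1 x (Suc k)"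
  proof -
    have "(g * S * d + g) / c = g * d / c * (S + 1 / d)" if "d \<noteq> 0" for g S c d :: real
      using that by (simp add: algebra_simps add_divide_distrib)
    from this[of "x - real k" "x gchoose k" "falling_power_sum 1 x k" "real (Suc k)"]
    show ?thesis
      unfolding rec using Suc.prems by (simp add: falling_power_sum_def)
  qed
  ultimately show ?case by (simp add: rec)
qed

lemma DERIV_falling_power_sum_1:
  assumes "real k < x + 1"
  shows "((\<lambda>x. falling_power_sum 1 x k) has_real_derivative - falling_power_sum 2 x k) (at x)"
proof -
  have "((\<lambda>x. 1 / (x - real i)) has_real_derivative - (1 / (x - real i)^2)) (at x)" if "i < k" for i
    using that assms by (auto intro!: derivative_eq_intros simp: power2_eq_square)
  then show ?thesis
    unfolding falling_power_sum_def sum_negf[symmetric] power_one_right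
    by (intro DERIV_sum) auto
qed

lemma Vandermonde_partial_derivative:
  fixes x y :: real
  assumes "real m < x + 1" "real m < y + 1" "real m < x + y + 1"
  shows "(\<Sum>j\<le>m. (x gchoose j) * falling_power_sum 1 x j * (y gchoose (m - j)))
       = ((x + y) gchoose m) * falling_power_sum 1 (x + y) m"
proof (rule DERIV_unique)
  show "((\<lambda>x. (x + y) gchoose m) has_real_derivative
      (\<Sum>j\<le>m. (x gchoose j) * falling_power_sum 1 x j * (y gchoose (m - j)))) (at x)"
    unfolding gbinomial_Vandermonde[symmetric] atLeast0AtMost
    by (intro DERIV_sum DERIV_cmult_right DERIV_gbinomial) (use assms in auto)
  show "((\<lambda>x. (x + y) gchoose m) has_real_derivative
      ((x + y) gchoose m) * falling_power_sum 1 (x + y) m) (at x)"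
    using DERIV_gbinomial[of m "x + y"] assms by (simp add: DERIV_shift)
qed

text \<open>The previous identity holds for all \<open>y\<close> in an open interval, hence can be differentiated
  once more, now in \<open>y\<close>.\<close>

lemma Vandermonde_mixed_derivative:
  fixes x y :: real
  assumes "real m < x + 1" "real m < y + 1" "real m < x + y + 1"
  shows "(\<Sum>j\<le>m. (x gchoose j) * falling_power_sum 1 x j
            * ((y gchoose (m - j)) * falling_power_sum 1 y (m - j)))
       = ((x + y) gchoose m) * ((falling_power_sum 1 (x + y) m)\<^sup>2 - falling_power_sum 2 (x + y) m)"
proof (rule DERIV_unique)
  let ?g = "\<lambda>s. (s gchoose m) * falling_power_sum 1 s m"
  show "((\<lambda>y. \<Sum>j\<le>m. (x gchoose j) * falling_power_sum 1 x j * (y gchoose (m - j)))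
      has_real_derivative (\<Sum>j\<le>m. (x gchoose j) * falling_power_sum 1 x j
            * ((y gchoose (m - j)) * falling_power_sum 1 y (m - j)))) (at y)"
    by (intro DERIV_sum DERIV_cmult DERIV_gbinomial) (use assms in auto)
  have "(?g has_real_derivative
      ((x + y) gchoose m) * ((falling_power_sum 1 (x + y) m)\<^sup>2 - falling_power_sum 2 (x + y) m)) (at (y + x))"
    using DERIV_mult[OF DERIV_gbinomial DERIV_falling_power_sum_1, of m "x + y" m] assms
    by (simp add: power2_eq_square algebra_simps)
  then have g: "((\<lambda>y. ?g (x + y)) has_real_derivative
      ((x + y) gchoose m) * ((falling_power_sum 1 (x + y) m)\<^sup>2 - falling_power_sum 2 (x + y) m)) (at y)"
    unfolding DERIV_shift by (simp only: add.commute)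
  \<comment> \<open>The bounds under which the first-order identity holds are open conditions on \<open>y\<close>.\<close>
  have near: "\<forall>\<^sub>F t in nhds y. max (real m - 1) (real m - 1 - x) < t"
    using assms by (intro order_tendstoD(1)[OF filterlim_ident]) auto
  have ev: "\<forall>\<^sub>F t in nhds y. (\<Sum>j\<le>m. (x gchoose j) * falling_power_sum 1 x j * (t gchoose (m - j)))
      = ?g (x + t)"
    using near by eventually_elim
      (rule Vandermonde_partial_derivative, use assms in auto)
  show "((\<lambda>y. \<Sum>j\<le>m. (x gchoose j) * falling_power_sum 1 x j * (y gchoose (m - j)))
      has_real_derivative
      ((x + y) gchoose m) * ((falling_power_sum 1 (x + y) m)\<^sup>2 - falling_power_sum 2 (x + y) m)) (at y)"
    using g DERIV_cong_ev[OF refl ev refl] by blast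
qed

text \<open>Each harmonic number with a \<open>j\<close>-dependent index is a constant minus a logarithmic derivative,
  which reduces the weighted sum to Vandermonde's convolution and its partial derivatives.\<close>

lemma Vandermonde_harm_harm:
  fixes m N M :: nat
  assumes "m \<le> N" "m \<le> M"
  defines "D \<equiv> harm (N + M) - harm (N + M - m)"
  shows "(\<Sum>j\<le>m. real (N choose j) * real (M choose (m - j)) * harm (N - j) * harm (M - (m - j)))
       = real ((N + M) choose m) *
         ((harm N - D) * (harm M - D) - (gen_harm 2 (N + M) - gen_harm 2 (N + M - m)))"
proof -
  define u where "u j = falling_power_sum 1 (real N) j" for j
  define v where "v j = falling_power_sum 1 (real M) j" for j
  let ?w = "\<lambda>j. real (N choose j) * real (M choose (m - j))"
  let ?C = "real ((N + M) choose m)"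
  have u: "harm (N - j) = harm N - u j" and v: "harm (M - (m - j)) = harm M - v (m - j)"
    if "j \<le> m" for j
    using that assms by (simp_all add: u_def v_def falling_power_sum_of_nat gen_harm_1 del: One_nat_def)
  have D: "falling_power_sum 1 (real N + real M) m = D"
    using falling_power_sum_of_nat[of m "N + M" 1] assms by (simp add: gen_harm_1 del: One_nat_def)
  have E: "falling_power_sum 2 (real N + real M) m = gen_harm 2 (N + M) - gen_harm 2 (N + M - m)"
    using falling_power_sum_of_nat[of m "N + M" 2] assms by simp
  have C: "(real N + real M) gchoose m = ?C"
    by (metis binomial_gbinomial of_nat_add)
  have sum_1: "(\<Sum>j\<le>m. ?w j) = ?C"
    using gbinomial_Vandermonde[of "real N" "real M" m]
    by (simp add: C atLeast0AtMost flip: binomial_gbinomial)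
  have sum_u: "(\<Sum>j\<le>m. ?w j * u j) = ?C * D"
    using Vandermonde_partial_derivative[of m "real N" "real M"] assms(1,2)
    by (simp add: C D u_def mult_ac del: One_nat_def flip: binomial_gbinomial)
  have "(\<Sum>j\<le>m. ?w j * v (m - j))
      = (\<Sum>j\<le>m. real (M choose j) * v j * real (N choose (m - j)))"
    by (rule sum.reindex_bij_witness[of _ "\<lambda>j. m - j" "\<lambda>j. m - j"]) auto
  also have "\<dots> = ?C * D"
    using Vandermonde_partial_derivative[of m "real M" "real N"] assms(1,2)
    by (simp add: C D v_def add.commute[of "real M"] del: One_nat_def flip: binomial_gbinomial)
  finally have sum_v: "(\<Sum>j\<le>m. ?w j * v (m - j)) = ?C * D" .
  have sum_uv: "(\<Sum>j\<le>m. ?w j * (u j * v (m - j)))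
      = ?C * (D\<^sup>2 - (gen_harm 2 (N + M) - gen_harm 2 (N + M - m)))"
    using Vandermonde_mixed_derivative[of m "real N" "real M"] assms(1,2)
    by (simp add: C D E u_def v_def mult_ac del: One_nat_def flip: binomial_gbinomial)
  have "(\<Sum>j\<le>m. ?w j * harm (N - j) * harm (M - (m - j)))
      = (\<Sum>j\<le>m. harm N * harm M * ?w j - harm M * (?w j * u j)
          - harm N * (?w j * v (m - j)) + ?w j * (u j * v (m - j)))"
    by (intro sum.cong refl, simp only: u v atMost_iff) (simp add: algebra_simps)
  also have "\<dots> = harm N * harm M * ?C - harm M * (?C * D) - harm N * (?C * D)
      + ?C * (D\<^sup>2 - (gen_harm 2 (N + M) - gen_harm 2 (N + M - m)))"
    by (simp only: sum.distrib sum_subtractf sum_distrib_left[symmetric] sum_1 sum_u sum_v sum_uv)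
  finally show ?thesis by (simp add: power2_eq_square algebra_simps)
qed

theorem theorem4:
  fixes p q n :: nat
  assumes "n \<ge> 1"
  shows "(\<Sum>k=1..n. real ((p + n) choose k) * real ((q + n) choose (n - k)) * real k
            * harm (p + n - k) * harm (q + k))
       = real (p + n) * real ((p + q + 2 * n - 1) choose (n - 1)) *
         ((gen_harm 2 (p + q + n) - gen_harm 2 (p + q + 2 * n - 1))
          + (harm (p + n - 1) + harm (p + q + n) - harm (p + q + 2 * n - 1))
            * (harm (q + n) + harm (p + q + n) - harm (p + q + 2 * n - 1)))"
proof -
  obtain m where n: "n = Suc m" using assms by (cases n) auto
  have absorb: "real ((p + n) choose Suc j) * real (Suc j) = real (p + n) * real ((p + m) choose j)" for j
    using Suc_times_binomial_eq[of "p + m" j]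
    by (simp only: n add_Suc_right mult.commute flip: of_nat_mult)
  have "(\<Sum>k=1..n. real ((p + n) choose k) * real ((q + n) choose (n - k)) * real k
            * harm (p + n - k) * harm (q + k))
      = (\<Sum>j\<le>m. (real ((p + n) choose Suc j) * real (Suc j)) *
            (real ((q + n) choose (m - j)) * harm (p + m - j) * harm (q + Suc j)))"
    by (rule sum.reindex_bij_witness[of _ Suc "\<lambda>k. k - 1"]) (auto simp: n)
  also have "\<dots> = real (p + n) * (\<Sum>j\<le>m. real ((p + m) choose j) * real ((q + n) choose (m - j))
            * harm (p + m - j) * harm (q + n - (m - j)))"
    unfolding absorb sum_distrib_left by (intro sum.cong refl) (simp add: n Suc_diff_le mult_ac)
  also have "\<dots> = real (p + n) * (real ((p + m + (q + n)) choose m) *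
      ((harm (p + m) - (harm (p + m + (q + n)) - harm (p + m + (q + n) - m))) *
       (harm (q + n) - (harm (p + m + (q + n)) - harm (p + m + (q + n) - m)))
        - (gen_harm 2 (p + m + (q + n)) - gen_harm 2 (p + m + (q + n) - m))))"
    by (subst Vandermonde_harm_harm) (auto simp: n)
  also have "p + m + (q + n) = p + q + 2 * n - 1" by (simp add: n)
  also have "p + q + 2 * n - 1 - m = p + q + n" by (simp add: n)
  finally show ?thesis by (simp add: n algebra_simps)
qed

end
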